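(* Let $m,n\geq 1$ be integers and let $\{\mathbf{k}_t\}_{t=1}^\infty$ be an arbitrary sequence of $n$-tuples of real numbers $\mathbf{k}_t=(k^{(t)}_1,\ldots,k^{(t)}_n)$ such that for every $t\in\mathbb{N}$ one has $k^{(t)}_j>0$ for $1\leq j\leq n$ and $\sum_{j=1}^n k^{(t)}_j=1$. Then for every matrix $\mathcal{L}\in\bigcap_{t=1}^\infty \mathbf{Bad}(\mathbf{k}_t,n,m)$ the intersection $$\bigcap_{t=1}^\infty \mathbf{Bad}_{\mathcal{L}}(\mathbf{k}_t,n,m)$$ is of maximal Hausdorff dimension, namely $n$.
   Context: Notation: $\|x\|$ is the distance from the real number $x$ to the nearest integer, and $|\mathbf{q}|=\max_i|q_i|$ is the supremum norm. For a real $n\times m$ matrix $\mathcal{L}=(x_{ji})_{1\leq j\leq n,\,1\leq i\leq m}$ put $L_j(\mathbf{q})=\sum_{i=1}^m q_i x_{ji}$ for $\mathbf q=(q_1,\dots,q_m)$ and $1\leq j\leq n$. Let $\mathbf{k}=(k_1,\dots,k_n)$ be an $n$-tuple of positive reals with sum $1$. $\mathbf{Bad}(\mathbf{k},n,m)$ is the set of all real $n\times m$ matrices $\mathcal{L}$ such that $$\inf_{\mathbf{q}\in\mathbb{Z}^m\setminus\{\mathbf{0}\}}\ \max_{1\leq j\leq n}\left(|\mathbf{q}|^{mk_j}\,\|L_j(\mathbf{q})\|\right)>0 .$$ For a real $n\times m$ matrix $\mathcal{L}$, $$\mathbf{Bad}_{\mathcal{L}}(\mathbf{k},n,m)=\left\{\boldsymbol\alpha=(\alpha_1,\dots,\alpha_n)\in[0,1)^n:\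 \inf_{\mathbf{q}\in\mathbb{Z}^m\setminus\{\mathbf{0}\}}\ \max_{1\leq j\leq n}\left(|\mathbf{q}|^{mk_j}\,\|L_j(\mathbf{q})-\alpha_j\|\right)>0\right\}.$$ *)

theory Defs
  imports "HOL-Analysis.Analysis"
begin

definition dist_nearest_int :: "real \<Rightarrow> real" where
  "dist_nearest_int x = infdist x \<int>"

definition int_vectors :: "(real ^ 'm) set" where
  "int_vectors = {q. \<forall>i. q $ i \<in> \<int>}"

text \<open>
  An \<open>n \<times> m\<close> real matrix is an element of type \<open>real ^ 'm ^ 'n\<close>; its \<open>j\<close>-th linear form
  evaluated at \<open>q\<close> is \<open>(L *v q) $ j\<close>.  The supremum norm of \<open>q\<close> is \<open>infnorm q\<close>.
\<close>

definition Bad :: "real ^ 'n \<Rightarrow> (real ^ 'm ^ 'n) set" where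
  "Bad k = {L. (INF q \<in> int_vectors - {0}.
      MAX j \<in> UNIV. infnorm q powr (real CARD('m) * k $ j) * dist_nearest_int ((L *v q) $ j)) > 0}"

definition Bad_affine :: "real ^ 'm ^ 'n \<Rightarrow> real ^ 'n \<Rightarrow> (real ^ 'n) set" where
  "Bad_affine L k = {\<alpha>. (\<forall>j. \<alpha> $ j \<in> {0..<1}) \<and>
      (INF q \<in> int_vectors - {0}.
        MAX j \<in> UNIV. infnorm q powr (real CARD('m) * k $ j)
          * dist_nearest_int ((L *v q) $ j - \<alpha> $ j)) > 0}"

text \<open>
  The contribution \<open>(diam U)\<^sup>s\<close> of a covering set, with the usual conventions \<open>0\<^sup>0 = 1\<close> for nonempty
  \<open>U\<close> and \<open>0\<close> for \<open>U = {}\<close>.  The case \<open>s = 0\<close> is separate since \<open>0 powr 0 = 0\<close>.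
\<close>

definition diam_power :: "real \<Rightarrow> 'a::metric_space set \<Rightarrow> ennreal" where
  "diam_power s U =
    (if U = {} then 0 else if s = 0 then 1 else ennreal (diameter U powr s))"

text \<open>
  Boundedness of the covering sets is required explicitly because \<open>diameter\<close> is real-valued
  and carries no meaning on unbounded sets.  Finite covers are included by padding with \<open>{}\<close>.
\<close>

definition hausdorff_premeasure :: "real \<Rightarrow> real \<Rightarrow> 'a::metric_space set \<Rightarrow> ennreal" where
  "hausdorff_premeasure s \<delta> E =
    (INF U \<in> {U :: nat \<Rightarrow> 'a set. E \<subseteq> (\<Union>i. U i) \<and> (\<forall>i. bounded (U i) \<and> diameter (U i) \<le> \<delta>)}.
      \<Sum>i. diam_power s (U i))"

definition hausdorff_measure :: "real \<Rightarrow> 'a::metric_space set \<Rightarrow> ennreal" where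
  "hausdorff_measure s E = (SUP \<delta> \<in> {0<..}. hausdorff_premeasure s \<delta> E)"

definition hausdorff_dim :: "'a::metric_space set \<Rightarrow> ennreal" where
  "hausdorff_dim E = Inf {ennreal s | s. s \<ge> 0 \<and> hausdorff_measure s E = 0}"

end

theory Submission
  imports Defs
begin

text \<open>
  Fix \<open>t\<close> and a shell \<open>X \<le> |q| < R X\<close>. A point \<open>\<alpha>\<close> is bad for \<open>q\<close> if it lies in a box with sides
  \<open>c |q| powr (- m k_j)\<close> about a translate of \<open>L q\<close>. Since \<open>L\<close> is in \<open>Bad k_t\<close>, the boxes of distinct
  \<open>q\<close> of the shell are well separated, so a cube with side comparable to \<open>X powr (- m max_j k_j)\<close> meets
  at most one of them, and it meets that one inside a thin slab orthogonal to the coordinate axis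
  where \<open>k_j\<close> is maximal. In a scheme of nested \<open>B\<close>-adic cubes, this costs at most \<open>3 B ^ (n - 1)\<close>
  of the \<open>B ^ n\<close> subcubes. Infinitely many \<open>t\<close> are handled at once by treating \<open>k_(t+1)\<close> only at the
  levels congruent to \<open>2 ^ t\<close> modulo \<open>2 ^ (t + 1)\<close>.

  For the dimension, let sets \<open>U_i\<close> with \<open>\<Sum> (diam U_i) powr \<sigma>\<close> small and \<open>\<sigma> < n\<close> be given. For large \<open>B\<close>
  one can choose the nested cubes \<open>Q\<close> such that the sum of \<open>(diam U_i) powr \<sigma>\<close> over those \<open>U_i\<close> that
  meet \<open>Q\<close> stays below \<open>(side Q / B) powr \<sigma>\<close>. The common point of the cubes then lies in no \<open>U_i\<close>,
  so the \<open>U_i\<close> do not cover the set.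
\<close>

section \<open>Counting the subcubes that meet a small set or a thin slab\<close>

lemma card_le_3_of_spread:
  fixes T :: "nat set"
  assumes "\<And>p p'. p \<in> T \<Longrightarrow> p' \<in> T \<Longrightarrow> p' \<le> p + 2"
  shows "card T \<le> 3"
proof (cases "T = {}")
  case False
  define l where "l = (LEAST p. p \<in> T)"
  have "l \<in> T" unfolding l_def using False by (metis LeastI equals0I)
  moreover have "l \<le> p" if "p \<in> T" for p
    unfolding l_def using that by (rule Least_le)
  ultimately have "T \<subseteq> {l..l+2}" using assms by auto
  then have "card T \<le> card {l..l+2}" by (intro card_mono) auto
  then show ?thesis by simp
qed simp

text \<open>Closed cubes make a nested sequence have a common point by compactness. The price is
  that neighbouring subcubes share faces.\<close>

definition cube :: "real ^ 'n \<Rightarrow> real \<Rightarrow> (real ^ 'n) set" where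
  "cube a h = cbox a (\<chi> i. a $ i + h)"

lemma mem_cube: "x \<in> cube a h \<longleftrightarrow> (\<forall>i. a $ i \<le> x $ i \<and> x $ i \<le> a $ i + h)"
  by (simp add: cube_def mem_box_cart)

definition subcube :: "real ^ 'n \<Rightarrow> real \<Rightarrow> ('n \<Rightarrow> nat) \<Rightarrow> (real ^ 'n) set" where
  "subcube a g f = cube (\<chi> i. a $ i + real (f i) * g) g"

text \<open>The extreme value \<open>f j + 2\<close> occurs only for boundary points at distance
  exactly \<open>g\<close>. Since the hypotheses are symmetric in \<open>x\<close> and
  \<open>y\<close>, all indices that occur lie within 2 of each other, which leaves three
  values.\<close>

lemma subcube_index_spread:
  assumes "x \<in> subcube a g f" "y \<in> subcube a g f'" "\<bar>x $ j - y $ j\<bar> \<le> g" "g > 0"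
  shows "f' j \<le> f j + 2"
proof -
  have "x $ j \<le> a $ j + real (f j) * g + g" "a $ j + real (f' j) * g \<le> y $ j"
    using assms(1,2) by (auto simp: subcube_def mem_cube)
  then have "real (f' j) * g \<le> (real (f j) + 2) * g"
    using assms(3) by (simp add: algebra_simps)
  then have "real (f' j) \<le> real (f j) + 2" using assms(4) by simp
  then show ?thesis by linarith
qed

lemma subcube_subset:
  assumes "\<And>i. f i < B" "g \<ge> 0"
  shows "subcube a g f \<subseteq> cube a (real B * g)"
proof
  fix x assume x: "x \<in> subcube a g f"
  show "x \<in> cube a (real B * g)"
    unfolding mem_cube
  proof
    fix i
    have *: "a $ i + real (f i) * g \<le> x $ i" "x $ i \<le> a $ i + real (f i) * g + g"
      using x by (auto simp: subcube_def mem_cube)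
    have "(real (f i) + 1) * g \<le> real B * g"
      using assms(1)[of i] assms(2) by (intro mult_right_mono) auto
    moreover have "real (f i) * g \<ge> 0" using assms(2) by simp
    moreover have "(real (f i) + 1) * g = real (f i) * g + g" by (simp add: distrib_right)
    ultimately show "a $ i \<le> x $ i \<and> x $ i \<le> a $ i + real B * g"
      using * by linarith
  qed
qed

text \<open>The index functions embed into the product of their coordinate projections, and each
  projection has at most three values.\<close>

lemma card_subcubes_meeting_small_set:
  fixes V :: "(real ^ 'n) set"
  assumes V: "\<And>x y i. x \<in> V \<Longrightarrow> y \<in> V \<Longrightarrow> \<bar>x $ i - y $ i\<bar> \<le> g" and "g > 0"
  shows "card {f \<in> UNIV \<rightarrow>\<^sub>E {..<B}. subcube a g f \<inter> V \<noteq> {}} \<le> 3 ^ CARD('n)"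
proof -
  let ?M = "{f \<in> UNIV \<rightarrow>\<^sub>E {..<B}. subcube a g f \<inter> V \<noteq> {}}"
  define T where "T i = (\<lambda>f. f i) ` ?M" for i
  have fin: "finite (UNIV \<rightarrow>\<^sub>E {..<B} :: ('n \<Rightarrow> nat) set)" by (intro finite_PiE) auto
  have finT: "finite (T i)" for i unfolding T_def using fin by auto
  have T3: "card (T i) \<le> 3" for i
  proof (rule card_le_3_of_spread)
    fix p p' assume "p \<in> T i" "p' \<in> T i"
    then obtain f f' x y where "p = f i" "p' = f' i" "x \<in> subcube a g f" "y \<in> subcube a g f'" "x \<in> V" "y \<in> V"
      by (auto simp: T_def)
    then show "p' \<le> p + 2" using subcube_index_spread[of x a g f y f' i] V \<open>g > 0\<close> by blast
  qed
  have "f i \<in> T i" if "f \<in> ?M" for f i using that unfolding T_def by (rule imageI)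
  then have "?M \<subseteq> PiE UNIV T" by (simp add: subset_iff PiE_iff)
  then have "card ?M \<le> card (PiE UNIV T)"
    using finT by (intro card_mono finite_PiE) auto
  also have "\<dots> = (\<Prod>i\<in>UNIV. card (T i))" by (simp add: card_PiE)
  also have "\<dots> \<le> (\<Prod>i\<in>(UNIV::'n set). 3)" by (intro prod_mono) (use T3 in auto)
  finally show ?thesis by simp
qed

text \<open>Only the index in direction \<open>j\<close> is confined to three values; each of the
  remaining directions contributes a full factor \<open>B\<close>.\<close>

lemma card_subcubes_meeting_slab:
  fixes V :: "(real ^ 'n) set"
  assumes V: "\<And>x y. x \<in> V \<Longrightarrow> y \<in> V \<Longrightarrow> \<bar>x $ j - y $ j\<bar> \<le> g" and "g > 0"
  shows "card {f \<in> UNIV \<rightarrow>\<^sub>E {..<B}. subcube a g f \<inter> V \<noteq> {}} \<le> 3 * B ^ (CARD('n) - 1)"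
proof -
  let ?M = "{f \<in> UNIV \<rightarrow>\<^sub>E {..<B}. subcube a g f \<inter> V \<noteq> {}}"
  define T where "T = (\<lambda>f. f j) ` ?M"
  have fin: "finite (UNIV \<rightarrow>\<^sub>E {..<B} :: ('n \<Rightarrow> nat) set)" by (intro finite_PiE) auto
  have finT: "finite T" unfolding T_def using fin by auto
  have T3: "card T \<le> 3"
  proof (rule card_le_3_of_spread)
    fix p p' assume "p \<in> T" "p' \<in> T"
    then obtain f f' x y where "p = f j" "p' = f' j" "x \<in> subcube a g f" "y \<in> subcube a g f'" "x \<in> V" "y \<in> V"
      by (auto simp: T_def)
    then show "p' \<le> p + 2" using subcube_index_spread[of x a g f y f' j] V \<open>g > 0\<close> by blast
  qed
  have T: "f j \<in> T" if "f \<in> ?M" for f using that unfolding T_def by (rule imageI)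
  have "?M \<subseteq> PiE UNIV (\<lambda>i. if i = j then T else {..<B})"
    using T by (simp add: subset_iff PiE_iff)
  then have "card ?M \<le> card (PiE UNIV (\<lambda>i. if i = j then T else {..<B}))"
    using finT by (intro card_mono finite_PiE) auto
  also have "\<dots> = (\<Prod>i\<in>UNIV. card (if i = j then T else {..<B}))" by (simp add: card_PiE)
  also have "\<dots> = card T * (\<Prod>i\<in>UNIV - {j}. card (if i = j then T else {..<B}))"
    by (subst prod.remove[of _ j]) auto
  also have "(\<Prod>i\<in>UNIV - {j}. card (if i = j then T else {..<B})) = (\<Prod>i\<in>UNIV - {j}. B)"
    by (intro prod.cong) auto
  also have "\<dots> = B ^ (CARD('n) - 1)" by simp
  finally show ?thesis using T3 by (meson le_trans mult_le_mono1)
qed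

section \<open>Weight of a cover inside a cube, and nested cubes that escape the cover\<close>

text \<open>A covering set counts in full for every cube that it meets. The weights of subcubes may
  therefore add up to more than that of the cube, and \<open>3 ^ CARD('n)\<close> bounds this
  overcount below.\<close>

definition cover_weight :: "(nat \<Rightarrow> 'a set) \<Rightarrow> (nat \<Rightarrow> real) \<Rightarrow> 'a set \<Rightarrow> real" where
  "cover_weight U w Q = (\<Sum>i. if U i \<inter> Q \<noteq> {} then w i else 0)"

lemma summable_cover_weight:
  fixes w :: "nat \<Rightarrow> real"
  assumes "summable w" "\<And>i. w i \<ge> 0"
  shows "summable (\<lambda>i. if P i then w i else 0)"
  by (rule summable_comparison_test[OF _ assms(1)]) (use assms(2) in auto)

lemma weight_le_cover_weight:
  assumes "summable w" "\<And>i. w i \<ge> 0" "U i \<inter> Q \<noteq> {}"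
  shows "w i \<le> cover_weight U w Q"
proof -
  have "sum (\<lambda>i. if U i \<inter> Q \<noteq> {} then w i else 0) {i} \<le> cover_weight U w Q"
    unfolding cover_weight_def
    by (intro sum_le_suminf summable_cover_weight) (use assms in auto)
  then show ?thesis using assms(3) by simp
qed

text \<open>
  A covering set meeting a cube of weight below \<open>g powr \<sigma>\<close> is shorter than \<open>g\<close>, so it meets at
  most \<open>3 ^ CARD('n)\<close> subcubes; averaging the weight over the subcubes that avoid \<open>E\<close> gives a light one.
\<close>

lemma exists_light_subcube:
  fixes U :: "nat \<Rightarrow> (real ^ 'n) set" and E :: "(real ^ 'n) set"
  assumes B: "3 ^ CARD('n) * real B powr \<sigma> \<le> real B ^ CARD('n) - 3 * real B ^ (CARD('n) - 1)"
    and "B > 0" "g > 0" "\<sigma> > 0"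
    and E: "\<And>x y. x \<in> E \<Longrightarrow> y \<in> E \<Longrightarrow> (\<forall>i. \<bar>x $ i - y $ i\<bar> \<le> real B * g) \<Longrightarrow> \<bar>x $ j - y $ j\<bar> \<le> g"
    and U: "\<And>i x y. x \<in> U i \<Longrightarrow> y \<in> U i \<Longrightarrow> dist x y \<le> d i"
    and d: "\<And>i. d i > 0" and summ: "summable (\<lambda>i. d i powr \<sigma>)"
    and W: "cover_weight U (\<lambda>i. d i powr \<sigma>) (cube a (real B * g)) < g powr \<sigma>"
  shows "\<exists>b. cube b g \<subseteq> cube a (real B * g) \<and> cube b g \<inter> E = {} \<and>
     cover_weight U (\<lambda>i. d i powr \<sigma>) (cube b g) < (g / real B) powr \<sigma>"
proof -
  let ?w = "\<lambda>i. d i powr \<sigma>" let ?Q = "cube a (real B * g)"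
  define F :: "('n \<Rightarrow> nat) set" where "F = UNIV \<rightarrow>\<^sub>E {..<B}"
  define G where "G = {f \<in> F. subcube a g f \<inter> E = {}}"
  have finF: "finite F" unfolding F_def by (intro finite_PiE) auto
  have GF: "G \<subseteq> F" by (auto simp: G_def)
  have finG: "finite G" using finite_subset[OF GF finF] .
  have sub: "subcube a g f \<subseteq> ?Q" if "f \<in> F" for f
    using that \<open>g > 0\<close> by (intro subcube_subset) (auto simp: F_def)
  have cardF: "card F = B ^ CARD('n)" by (simp add: F_def card_PiE)
  \<comment> \<open>The hypothesis on \<open>E\<close> compares only points that are close in all
    coordinates, so \<open>E\<close> is first cut down to \<open>?Q\<close>. As the subcubes lie in
    \<open>?Q\<close>, this changes none of their intersections with \<open>E\<close>.\<close>
  have "card {f \<in> F. subcube a g f \<inter> (E \<inter> ?Q) \<noteq> {}} \<le> 3 * B ^ (CARD('n) - 1)"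
    unfolding F_def
  proof (rule card_subcubes_meeting_slab[of _ j, OF _ \<open>g > 0\<close>])
    fix x y assume xy: "x \<in> E \<inter> ?Q" "y \<in> E \<inter> ?Q"
    have "\<bar>x $ i - y $ i\<bar> \<le> real B * g" for i
    proof -
      have "a $ i \<le> x $ i" "x $ i \<le> a $ i + real B * g" "a $ i \<le> y $ i" "y $ i \<le> a $ i + real B * g"
        using xy by (auto simp: mem_cube)
      then show ?thesis by linarith
    qed
    then show "\<bar>x $ j - y $ j\<bar> \<le> g" using E xy by blast
  qed
  moreover have "subcube a g f \<inter> (E \<inter> ?Q) = subcube a g f \<inter> E" if "f \<in> F" for f
    using sub[OF that] by blast
  then have "{f \<in> F. subcube a g f \<inter> (E \<inter> ?Q) \<noteq> {}} = F - G"
    unfolding G_def by auto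
  ultimately have "card F - card G \<le> 3 * B ^ (CARD('n) - 1)"
    by (simp only: card_Diff_subset[OF finG GF])
  then have "B ^ CARD('n) \<le> card G + 3 * B ^ (CARD('n) - 1)" using cardF by simp
  then have "real (B ^ CARD('n)) \<le> real (card G + 3 * B ^ (CARD('n) - 1))"
    by (rule of_nat_mono)
  then have cardG: "3 ^ CARD('n) * real B powr \<sigma> \<le> real (card G)"
    using B by simp
  \<comment> \<open>Double counting: after the sums are exchanged, each \<open>U i\<close> that
    meets \<open>?Q\<close> contributes its weight once for every good subcube that it
    meets.\<close>
  have "(\<Sum>f\<in>G. cover_weight U ?w (subcube a g f))
      = (\<Sum>i. \<Sum>f\<in>G. if U i \<inter> subcube a g f \<noteq> {} then ?w i else 0)"
    unfolding cover_weight_def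
    by (rule suminf_sum[symmetric]) (intro summable_cover_weight, use summ in auto)
  also have "\<dots> \<le> (\<Sum>i. 3 ^ CARD('n) * (if U i \<inter> ?Q \<noteq> {} then ?w i else 0))"
  proof (rule suminf_le)
    fix i
    have *: "(\<Sum>f\<in>G. if U i \<inter> subcube a g f \<noteq> {} then ?w i else 0)
        = real (card {f\<in>G. U i \<inter> subcube a g f \<noteq> {}}) * ?w i"
      using finG by (simp add: sum.If_cases Int_def)
    show "(\<Sum>f\<in>G. if U i \<inter> subcube a g f \<noteq> {} then ?w i else 0)
        \<le> 3 ^ CARD('n) * (if U i \<inter> ?Q \<noteq> {} then ?w i else 0)"
    proof (cases "U i \<inter> ?Q = {}")
      case True
      have "U i \<inter> subcube a g f = {}" if "f \<in> G" for f
        using True sub[of f] GF that by blast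
      then show ?thesis using True by simp
    next
      case False
      have "?w i < g powr \<sigma>"
        using weight_le_cover_weight[of ?w U i ?Q] summ False W by simp
      then have "d i < g" using \<open>g > 0\<close> \<open>\<sigma> > 0\<close> d[of i]
        by (meson linorder_not_le order.strict_iff_not powr_mono2 less_imp_le)
      have "card {f\<in>F. subcube a g f \<inter> U i \<noteq> {}} \<le> 3 ^ CARD('n)"
        unfolding F_def
      proof (rule card_subcubes_meeting_small_set[OF _ \<open>g > 0\<close>])
        fix x y l assume "x \<in> U i" "y \<in> U i"
        then show "\<bar>x $ l - y $ l\<bar> \<le> g"
          using U[of x i y] \<open>d i < g\<close> dist_vec_nth_le[of x l y] by (simp add: dist_real_def)
      qed
      moreover have "card {f\<in>G. U i \<inter> subcube a g f \<noteq> {}} \<le> card {f\<in>F. subcube a g f \<inter> U i \<noteq> {}}"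
        using finF GF by (intro card_mono) auto
      ultimately have "card {f\<in>G. U i \<inter> subcube a g f \<noteq> {}} \<le> 3 ^ CARD('n)" by linarith
      then have "real (card {f\<in>G. U i \<inter> subcube a g f \<noteq> {}}) \<le> real (3 ^ CARD('n))"
        by (rule of_nat_mono)
      then show ?thesis unfolding * using False by (simp add: mult_right_mono)
    qed
  next
    show "summable (\<lambda>i. \<Sum>f\<in>G. if U i \<inter> subcube a g f \<noteq> {} then ?w i else 0)"
      by (intro summable_sum summable_cover_weight) (use summ in auto)
    show "summable (\<lambda>i. 3 ^ CARD('n) * (if U i \<inter> ?Q \<noteq> {} then ?w i else 0))"
      by (intro summable_mult summable_cover_weight) (use summ in auto)
  qed
  also have "\<dots> = 3 ^ CARD('n) * cover_weight U ?w ?Q"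
    unfolding cover_weight_def
    by (intro suminf_mult summable_cover_weight) (use summ in auto)
  also have "\<dots> < 3 ^ CARD('n) * g powr \<sigma>" using W by simp
  finally have less: "(\<Sum>f\<in>G. cover_weight U ?w (subcube a g f)) < 3 ^ CARD('n) * g powr \<sigma>" .
  \<comment> \<open>If no good subcube were light, the total would be at least
    \<open>card G * (g / real B) powr \<sigma>\<close>, hence at least
    \<open>3 ^ CARD('n) * g powr \<sigma>\<close> by the lower bound for
    \<open>card G\<close>.\<close>
  have "\<exists>f\<in>G. cover_weight U ?w (subcube a g f) < (g / real B) powr \<sigma>"
  proof (rule ccontr)
    assume "\<not> ?thesis"
    then have "real (card G) * (g / real B) powr \<sigma> \<le> (\<Sum>f\<in>G. cover_weight U ?w (subcube a g f))"
      by (intro sum_bounded_below) (auto simp: not_less)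
    moreover have "3 ^ CARD('n) * real B powr \<sigma> * (g / real B) powr \<sigma> \<le> real (card G) * (g / real B) powr \<sigma>"
      using cardG by (intro mult_right_mono) auto
    moreover have "real B powr \<sigma> * (g / real B) powr \<sigma> = g powr \<sigma>"
      using \<open>g > 0\<close> \<open>B > 0\<close> by (simp add: powr_mult[symmetric])
    ultimately show False using less by (simp add: mult.assoc)
  qed
  then obtain f where "f \<in> G" "cover_weight U ?w (subcube a g f) < (g / real B) powr \<sigma>" by blast
  moreover have "f \<in> F" "subcube a g f \<inter> E = {}" using \<open>f \<in> G\<close> by (simp_all add: G_def)
  ultimately show ?thesis using sub[of f] unfolding subcube_def by blast
qed

text \<open>Iterates \<open>exists_light_subcube\<close>. The start is the cube of side
  \<open>1 / real B\<close> at the origin, which keeps the limit point inside the half-open unit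
  cube. Hence \<open>E 0\<close> is never avoided, and the smallness hypothesis is the weight bound
  for this first cube.\<close>

lemma exists_point_avoiding:
  fixes U :: "nat \<Rightarrow> (real ^ 'n) set" and E :: "nat \<Rightarrow> (real ^ 'n) set"
  assumes B: "3 ^ CARD('n) * real B powr \<sigma> \<le> real B ^ CARD('n) - 3 * real B ^ (CARD('n) - 1)"
    and "B > 1" "\<sigma> > 0"
    and E: "\<And>s. \<exists>j. \<forall>x\<in>E s. \<forall>y\<in>E s. (\<forall>i. \<bar>x $ i - y $ i\<bar> \<le> (1 / real B) ^ s)
              \<longrightarrow> \<bar>x $ j - y $ j\<bar> \<le> (1 / real B) ^ Suc s"
    and U: "\<And>i x y. x \<in> U i \<Longrightarrow> y \<in> U i \<Longrightarrow> dist x y \<le> d i"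
    and d: "\<And>i. d i > 0" and summ: "summable (\<lambda>i. d i powr \<sigma>)"
    and small: "(\<Sum>i. d i powr \<sigma>) < ((1 / real B) ^ 2) powr \<sigma>"
  shows "\<exists>x. (\<forall>i. x $ i \<in> {0..<1}) \<and> (\<forall>i. x \<notin> U i) \<and> (\<forall>s\<ge>1. x \<notin> E s)"
proof -
  let ?w = "\<lambda>i. d i powr \<sigma>"
  define h where "h s = (1 / real B) ^ s" for s
  have h0: "h s > 0" for s using \<open>B > 1\<close> by (simp add: h_def)
  have hS: "h s = real B * h (Suc s)" "h (Suc s) / real B = h (Suc (Suc s))" for s
    using \<open>B > 1\<close> by (simp_all add: h_def)
  have step: "\<exists>b. cover_weight U ?w (cube b (h (Suc s))) < h (Suc (Suc s)) powr \<sigma>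
      \<and> cube b (h (Suc s)) \<subseteq> cube a (h s) \<and> cube b (h (Suc s)) \<inter> E s = {}"
    if "cover_weight U ?w (cube a (h s)) < h (Suc s) powr \<sigma>" for a s
  proof -
    obtain j where j: "\<forall>x\<in>E s. \<forall>y\<in>E s. (\<forall>i. \<bar>x $ i - y $ i\<bar> \<le> h s) \<longrightarrow> \<bar>x $ j - y $ j\<bar> \<le> h (Suc s)"
      using E[of s] unfolding h_def by blast
    show ?thesis
      using exists_light_subcube[of B \<sigma> "h (Suc s)" "E s" j U d a, OF B _ h0 \<open>\<sigma> > 0\<close> _ U d summ]
        that j \<open>B > 1\<close> unfolding hS(2) hS(1)[symmetric] by auto
  qed
  have "cover_weight U ?w (cube 0 (h 1)) \<le> (\<Sum>i. ?w i)"
    unfolding cover_weight_def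
    by (intro suminf_le summable_cover_weight) (use summ in auto)
  then have base: "cover_weight U ?w (cube 0 (h (Suc 0))) < h (Suc (Suc 0)) powr \<sigma>"
    using small by (simp add: h_def power2_eq_square)
  \<comment> \<open>The indices are shifted: \<open>a s\<close> is the corner of the cube of level
    \<open>Suc s\<close>. The clause for \<open>s = 0\<close> carries the starting point through the
    choice principle.\<close>
  have "\<exists>a. \<forall>s. (cover_weight U ?w (cube (a s) (h (Suc s))) < h (Suc (Suc s)) powr \<sigma> \<and> (s = 0 \<longrightarrow> a s = 0)) \<and>
      (cube (a (Suc s)) (h (Suc (Suc s))) \<subseteq> cube (a s) (h (Suc s)) \<and> cube (a (Suc s)) (h (Suc (Suc s))) \<inter> E (Suc s) = {})"
  proof (rule dependent_nat_choice)
    show "\<exists>x. cover_weight U ?w (cube x (h (Suc 0))) < h (Suc (Suc 0)) powr \<sigma> \<and> (0 = 0 \<longrightarrow> x = 0)"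
      using base by blast
  next
    fix x and s :: nat
    assume "cover_weight U ?w (cube x (h (Suc s))) < h (Suc (Suc s)) powr \<sigma> \<and> (s = 0 \<longrightarrow> x = 0)"
    then show "\<exists>y. (cover_weight U ?w (cube y (h (Suc (Suc s)))) < h (Suc (Suc (Suc s))) powr \<sigma> \<and> (Suc s = 0 \<longrightarrow> y = 0)) \<and>
        cube y (h (Suc (Suc s))) \<subseteq> cube x (h (Suc s)) \<and> cube y (h (Suc (Suc s))) \<inter> E (Suc s) = {}"
      using step[of x "Suc s"] by auto
  qed
  then obtain a where a: "\<And>s. cover_weight U ?w (cube (a s) (h (Suc s))) < h (Suc (Suc s)) powr \<sigma> \<and> (s = 0 \<longrightarrow> a s = 0)"
    "\<And>s. cube (a (Suc s)) (h (Suc (Suc s))) \<subseteq> cube (a s) (h (Suc s)) \<and> cube (a (Suc s)) (h (Suc (Suc s))) \<inter> E (Suc s) = {}"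
    by blast
  define C where "C s = cube (a s) (h (Suc s))" for s
  have "C (Suc s) \<subseteq> C s" for s using a(2) by (simp add: C_def)
  then have dec: "C n \<subseteq> C m" if "m \<le> n" for m n
    using that by (rule lift_Suc_antimono_le)
  have "\<Inter>(range C) \<noteq> {}"
  proof (rule compact_nest)
    show "compact (C n)" for n by (simp add: C_def cube_def)
    have "a n \<in> C n" for n using h0[of "Suc n"] by (simp add: C_def mem_cube)
    then show "C n \<noteq> {}" for n by blast
  qed (use dec in blast)
  then obtain x where x: "\<And>s. x \<in> C s" by auto
  have "x $ i \<in> {0..<1}" for i
  proof -
    have "x \<in> cube 0 (h (Suc 0))" using x[of 0] a(1)[of 0] by (simp add: C_def)
    then have "0 \<le> x $ i" "x $ i \<le> 1 / real B" by (auto simp: mem_cube h_def)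
    moreover have "1 / real B < 1" using \<open>B > 1\<close> by simp
    ultimately show ?thesis by simp
  qed
  moreover have "x \<notin> U i" for i
  proof
    assume "x \<in> U i"
    \<comment> \<open>If \<open>x\<close> were in \<open>U i\<close>, then \<open>U i\<close> would
      meet every cube \<open>C n\<close>, so the fixed positive number
      \<open>d i powr \<sigma>\<close> would stay below weight bounds that tend to 0.\<close>
    have "\<exists>n. (1 / real B) ^ n < d i"
      using \<open>B > 1\<close> d by (intro real_arch_pow_inv) auto
    then obtain n where n: "h n < d i" unfolding h_def by blast
    have "h (Suc (Suc n)) \<le> h n" unfolding h_def
      using \<open>B > 1\<close> by (intro power_decreasing) auto
    with n have "h (Suc (Suc n)) powr \<sigma> \<le> ?w i"
      using h0[of "Suc (Suc n)"] \<open>\<sigma> > 0\<close> by (intro powr_mono2) auto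
    also have "?w i \<le> cover_weight U ?w (C n)"
      using \<open>x \<in> U i\<close> x[of n] summ by (intro weight_le_cover_weight) auto
    also have "\<dots> < h (Suc (Suc n)) powr \<sigma>" using a(1) by (simp add: C_def)
    finally show False by simp
  qed
  moreover have "x \<notin> E s" if s: "s \<ge> 1" for s
  proof -
    obtain r where "s = Suc r" using s by (cases s) auto
    then show ?thesis using a(2)[of r] x[of "Suc r"] by (auto simp: C_def)
  qed
  ultimately show ?thesis by blast
qed

section \<open>Bounds for Hausdorff measure and dimension\<close>

text \<open>For diameters at most 1, powers decrease as the exponent grows. This passes from
  \<open>s\<close> to a positive \<open>\<sigma>\<close> and so also handles \<open>s = 0\<close>,
  where every nonempty set counts 1.\<close>

lemma diam_power_mono_exponent:
  assumes "0 \<le> s" "s \<le> \<sigma>" "0 < \<sigma>" "diameter U \<le> 1" "bounded U" "U \<noteq> {}"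
  shows "ennreal (diameter U powr \<sigma>) \<le> diam_power s U"
proof -
  have "diameter U \<ge> 0" using assms(5) by (rule diameter_ge_0)
  then have "diameter U powr \<sigma> \<le> (if s = 0 then 1 else diameter U powr s)"
    using assms by (auto intro: powr_le1 powr_mono')
  then show ?thesis using assms(6) by (auto simp: diam_power_def intro: ennreal_leI)
qed

text \<open>Singletons have diameter \<open>0\<close>, so the weights \<open>d i\<close> are only upper bounds for the diameters and
  can be kept positive.\<close>

lemma hausdorff_measure_pos_if_not_covered:
  fixes A :: "'a::metric_space set"
  assumes "0 \<le> s" "s \<le> \<sigma>" "0 < \<sigma>" "\<eta> > 0"
    and not_covered: "\<And>(U :: nat \<Rightarrow> 'a set) d. (\<And>i x y. x \<in> U i \<Longrightarrow> y \<in> U i \<Longrightarrow> dist x y \<le> d i) \<Longrightarrow>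
        (\<And>i. d i > 0) \<Longrightarrow> summable (\<lambda>i. d i powr \<sigma>) \<Longrightarrow> (\<Sum>i. d i powr \<sigma>) < \<eta> \<Longrightarrow> \<not> A \<subseteq> (\<Union>i. U i)"
  shows "hausdorff_measure s A \<noteq> 0"
proof
  assume "hausdorff_measure s A = 0"
  \<comment> \<open>The scale 1 forces all diameters to be at most 1, as the change of exponent
    requires.\<close>
  moreover have "hausdorff_premeasure s 1 A \<le> hausdorff_measure s A"
    unfolding hausdorff_measure_def by (rule SUP_upper) simp
  ultimately have "hausdorff_premeasure s 1 A < ennreal (\<eta> / 2)" using \<open>\<eta> > 0\<close> by simp
  then obtain U where U: "A \<subseteq> (\<Union>i. U i)" "\<And>i. bounded (U i)" "\<And>i. diameter (U i) \<le> 1"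
    and less: "(\<Sum>i. diam_power s (U i)) < ennreal (\<eta> / 2)"
    unfolding hausdorff_premeasure_def INF_less_iff by blast
  define w where "w i = diameter (U i) powr \<sigma>" for i
  have w: "ennreal (w i) \<le> diam_power s (U i)" for i
    using assms U diam_power_mono_exponent[of s \<sigma> "U i"]
    by (cases "U i = {}") (auto simp: w_def)
  have "(\<Sum>i. ennreal (w i)) \<le> (\<Sum>i. diam_power s (U i))"
    using w by (intro suminf_le) auto
  with less have fin: "(\<Sum>i. ennreal (w i)) < ennreal (\<eta> / 2)" by (rule le_less_trans[rotated])
  have w0: "w i \<ge> 0" for i by (simp add: w_def)
  have sw: "summable w"
    using fin w0 by (intro summable_suminf_not_top) (auto simp: top_unique)
  then have "ennreal (\<Sum>i. w i) < ennreal (\<eta> / 2)" using fin w0 by (simp add: suminf_ennreal2)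
  then have sumw: "(\<Sum>i. w i) < \<eta> / 2" using w0 by (simp add: ennreal_less_iff suminf_nonneg sw)
  \<comment> \<open>The padding sums to \<open>\<eta> / 2\<close>, the other half of the budget;
    \<open>d i\<close> is then defined so that \<open>d i powr \<sigma>\<close> is exactly
    \<open>w i + e i\<close>.\<close>
  define e where "e i = \<eta> / 2 * (1 / 2) ^ Suc i" for i
  have e0: "e i > 0" for i using \<open>\<eta> > 0\<close> by (simp add: e_def)
  have esums: "e sums (\<eta> / 2 * 1)"
    unfolding e_def by (intro sums_mult power_half_series)
  define d where "d i = (w i + e i) powr (1 / \<sigma>)" for i
  have dpow: "d i powr \<sigma> = w i + e i" for i
    using w0[of i] e0[of i] \<open>\<sigma> > 0\<close> by (simp add: d_def powr_powr)
  have "\<not> A \<subseteq> (\<Union>i. U i)"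
  proof (rule not_covered)
    show "d i > 0" for i using w0[of i] e0[of i] by (simp add: d_def)
    show "summable (\<lambda>i. d i powr \<sigma>)"
      unfolding dpow using sw esums by (intro summable_add) (auto simp: sums_iff)
    have "(\<Sum>i. d i powr \<sigma>) = (\<Sum>i. w i) + (\<Sum>i. e i)"
      unfolding dpow using sw esums by (intro suminf_add[symmetric]) (auto simp: sums_iff)
    then show "(\<Sum>i. d i powr \<sigma>) < \<eta>" using sumw esums by (auto simp: sums_iff)
    fix i x y assume "x \<in> U i" "y \<in> U i"
    then have "dist x y \<le> diameter (U i)" using U(2) by (intro diameter_bounded_bound)
    also have "\<dots> = w i powr (1 / \<sigma>)"
      using diameter_ge_0[OF U(2)] \<open>\<sigma> > 0\<close> by (simp add: w_def powr_powr)
    also have "\<dots> \<le> d i"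
      unfolding d_def using w0[of i] e0[of i] \<open>\<sigma> > 0\<close> by (intro powr_mono2) auto
    finally show "dist x y \<le> d i" .
  qed
  then show False using U(1) by simp
qed

lemma hausdorff_premeasure_le_finite_cover:
  fixes V :: "'b \<Rightarrow> 'a::metric_space set"
  assumes "finite I" "\<And>f. f \<in> I \<Longrightarrow> bounded (V f)" "\<And>f. f \<in> I \<Longrightarrow> diameter (V f) \<le> \<delta>" "\<delta> \<ge> 0" "s > 0"
    "A \<subseteq> (\<Union>f\<in>I. V f)"
  shows "hausdorff_premeasure s \<delta> A \<le> ennreal (real (card I) * \<delta> powr s)"
proof -
  obtain g where g: "bij_betw g {0..<card I} I" using assms(1) ex_bij_betw_nat_finite by blast
  define U where "U i = (if i < card I then V (g i) else {})" for i
  have gI: "g i \<in> I" if "i < card I" for i using g that by (auto simp: bij_betw_def)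
  have "A \<subseteq> (\<Union>i. U i)"
  proof
    fix x assume "x \<in> A"
    then obtain f where f: "f \<in> I" "x \<in> V f" using assms(6) by blast
    then obtain i where "i < card I" "g i = f" using g by (force simp: bij_betw_def)
    then have "x \<in> U i" using f by (simp add: U_def)
    then show "x \<in> (\<Union>i. U i)" by blast
  qed
  moreover have "bounded (U i)" "diameter (U i) \<le> \<delta>" for i
    using assms gI by (auto simp: U_def)
  ultimately have "hausdorff_premeasure s \<delta> A \<le> (\<Sum>i. diam_power s (U i))"
    unfolding hausdorff_premeasure_def by (intro INF_lower) auto
  also have "\<dots> = (\<Sum>i<card I. diam_power s (U i))"
    by (intro suminf_finite) (auto simp: U_def diam_power_def)
  also have "\<dots> \<le> (\<Sum>i<card I. ennreal (\<delta> powr s))"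
    using assms gI by (intro sum_mono)
      (auto simp: U_def diam_power_def intro!: ennreal_leI powr_mono2 diameter_ge_0)
  also have "\<dots> = ennreal (real (card I) * \<delta> powr s)"
    by (simp add: ennreal_mult ennreal_of_nat_eq_real_of_nat)
  finally show ?thesis .
qed

text \<open>The grid of \<open>N ^ CARD('n)\<close> cubes of side \<open>1 / real N\<close>, with
  diameters at most \<open>?n / real N\<close>, has total contribution at most
  \<open>real N powr (?n - s) * ?n powr s\<close>, which tends to 0. Premeasures only grow as the
  scale shrinks, so this bounds the premeasure at every fixed scale.\<close>

lemma hausdorff_measure_unit_cube_eq_0:
  fixes A :: "(real ^ 'n) set"
  assumes A: "A \<subseteq> cube 0 1" and s: "s > real CARD('n)"
  shows "hausdorff_measure s A = 0"
proof -
  let ?n = "real CARD('n)"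
  have n: "?n \<ge> 1" by (simp add: Suc_leI)
  have bound: "hausdorff_premeasure s (?n / real N) A \<le> ennreal (real N powr (?n - s) * ?n powr s)"
    if "N > 0" for N :: nat
  proof -
    define I :: "('n \<Rightarrow> nat) set" where "I = UNIV \<rightarrow>\<^sub>E {..<N}"
    have "finite I" unfolding I_def by (intro finite_PiE) auto
    moreover have "card I = N ^ CARD('n)" by (simp add: I_def card_PiE)
    moreover have "bounded (subcube 0 (1 / real N) f)" for f :: "'n \<Rightarrow> nat"
      by (simp add: subcube_def cube_def bounded_cbox)
    moreover have "diameter (subcube 0 (1 / real N) f) \<le> ?n / real N" for f :: "'n \<Rightarrow> nat"
    proof (rule diameter_le)
      fix x y assume xy: "x \<in> subcube 0 (1 / real N) f" "y \<in> subcube 0 (1 / real N) f"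
      have "norm (x - y) \<le> (\<Sum>i\<in>UNIV. \<bar>(x - y) $ i\<bar>)" by (rule norm_le_l1_cart)
      also have "\<dots> \<le> (\<Sum>i\<in>(UNIV::'n set). 1 / real N)"
      proof (rule sum_mono)
        fix i show "\<bar>(x - y) $ i\<bar> \<le> 1 / real N"
          using xy unfolding subcube_def mem_cube by (auto simp: abs_le_iff dest!: spec[of _ i])
      qed
      finally show "norm (x - y) \<le> ?n / real N" by simp
    qed simp
    moreover have "A \<subseteq> (\<Union>f\<in>I. subcube 0 (1 / real N) f)"
    proof
      fix x assume "x \<in> A"
      then have x: "0 \<le> x $ i" "x $ i \<le> 1" for i using A by (force simp: mem_cube)+
      have "\<exists>k<N. real k / real N \<le> x $ i \<and> x $ i \<le> real k / real N + 1 / real N" for i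
      \<comment> \<open>At the right end point the floor would give the index \<open>N\<close>,
        which is out of range; the last closed interval contains the point instead.\<close>
      proof (cases "x $ i = 1")
        case True
        then show ?thesis using \<open>N > 0\<close>
          by (intro exI[of _ "N - 1"]) (auto simp: field_simps of_nat_diff)
      next
        case False
        define k where "k = nat \<lfloor>real N * x $ i\<rfloor>"
        have k: "real k \<le> real N * x $ i" "real N * x $ i < real k + 1"
          using x[of i] by (auto simp: k_def)
        have "real N * x $ i < real N * 1" using False x[of i] \<open>N > 0\<close> by (intro mult_strict_left_mono) auto
        then have "k < N" using k by linarith
        then show ?thesis using k \<open>N > 0\<close> by (intro exI[of _ k]) (auto simp: field_simps)
      qed
      then obtain f where f: "\<And>i. f i < N"
        "\<And>i. real (f i) / real N \<le> x $ i \<and> x $ i \<le> real (f i) / real N + 1 / real N"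
        by metis
      then have "f \<in> I" "x \<in> subcube 0 (1 / real N) f"
        by (auto simp: I_def subcube_def mem_cube)
      then show "x \<in> (\<Union>f\<in>I. subcube 0 (1 / real N) f)" by blast
    qed
    ultimately have "hausdorff_premeasure s (?n / real N) A \<le> ennreal (real (card I) * (?n / real N) powr s)"
      using s n by (intro hausdorff_premeasure_le_finite_cover[where V = "subcube 0 (1 / real N)"]) auto
    also have "real (card I) * (?n / real N) powr s = real N powr (?n - s) * ?n powr s"
      using \<open>N > 0\<close> \<open>card I = _\<close> n
      by (simp add: powr_divide powr_diff powr_realpow)
    finally show ?thesis .
  qed
  have premeasure_mono: "hausdorff_premeasure s \<delta> A \<le> hausdorff_premeasure s \<delta>' A" if "\<delta>' \<le> \<delta>" for \<delta> \<delta>'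
    unfolding hausdorff_premeasure_def
    by (intro INF_superset_mono) (use that in \<open>auto intro: order_trans\<close>)
  have "hausdorff_premeasure s \<delta> A \<le> 0" if "\<delta> > 0" for \<delta>
  proof (rule tendsto_lowerbound)
    have "((\<lambda>N. real N powr (?n - s)) \<longlongrightarrow> 0) sequentially"
      using s by (intro tendsto_neg_powr filterlim_real_sequentially) auto
    then have "((\<lambda>N. ennreal (real N powr (?n - s) * ?n powr s)) \<longlongrightarrow> ennreal (0 * ?n powr s)) sequentially"
      by (intro tendsto_ennrealI tendsto_mult tendsto_const)
    then show "((\<lambda>N. ennreal (real N powr (?n - s) * ?n powr s)) \<longlongrightarrow> 0) sequentially" by simp
    have "((\<lambda>N. ?n / real N) \<longlongrightarrow> 0) sequentially"
      by (intro real_tendsto_divide_at_top[OF tendsto_const] filterlim_real_sequentially)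
    then have "\<forall>\<^sub>F N in sequentially. ?n / real N < \<delta>" using that by (rule order_tendstoD)
    then show "\<forall>\<^sub>F N in sequentially. hausdorff_premeasure s \<delta> A \<le> ennreal (real N powr (?n - s) * ?n powr s)"
      using eventually_gt_at_top[of 0]
    proof eventually_elim
      case (elim N)
      then show ?case using premeasure_mono[of "?n / real N" \<delta>] bound[of N] by (meson less_imp_le order_trans)
    qed
  qed simp
  then show ?thesis unfolding hausdorff_measure_def by (auto intro!: antisym SUP_least)
qed

lemma hausdorff_dim_eqI:
  fixes A :: "(real ^ 'n) set"
  assumes "A \<subseteq> cube 0 1"
    and pos: "\<And>s. 0 \<le> s \<Longrightarrow> s < real CARD('n) \<Longrightarrow> hausdorff_measure s A \<noteq> 0"
  shows "hausdorff_dim A = of_nat CARD('n)"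
proof (rule antisym)
  let ?n = "real CARD('n)"
  show "hausdorff_dim A \<le> of_nat CARD('n)"
  proof (rule ennreal_le_epsilon)
    fix e :: real assume "e > 0"
    have "hausdorff_dim A \<le> ennreal (?n + e)"
      unfolding hausdorff_dim_def
      using hausdorff_measure_unit_cube_eq_0[OF assms(1), of "?n + e"] \<open>e > 0\<close>
      by (intro Inf_lower CollectI exI[of _ "?n + e"]) auto
    then show "hausdorff_dim A \<le> of_nat CARD('n) + ennreal e"
      using \<open>e > 0\<close> by (simp add: ennreal_of_nat_eq_real_of_nat)
  qed
  show "of_nat CARD('n) \<le> hausdorff_dim A"
    unfolding hausdorff_dim_def
  proof (rule Inf_greatest)
    fix z assume "z \<in> {ennreal s |s. s \<ge> 0 \<and> hausdorff_measure s A = 0}"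
    then obtain s where "z = ennreal s" "s \<ge> 0" "hausdorff_measure s A = 0" by blast
    moreover from this pos have "?n \<le> s" by (meson not_less)
    ultimately show "of_nat CARD('n) \<le> z" by (simp add: ennreal_of_nat_eq_real_of_nat ennreal_leI)
  qed
qed

text \<open>After division by \<open>real B ^ n\<close> the terms become multiples of
  \<open>real B powr (\<sigma> - real n)\<close> and \<open>inverse (real B)\<close>, both tending
  to 0. The inequality leaves enough subcubes for the averaging once a slab is removed.\<close>

lemma exists_base:
  assumes "\<sigma> < real n" "n > 0"
  shows "\<exists>B>1. 3 ^ n * real B powr \<sigma> \<le> real B ^ n - 3 * real B ^ (n - 1)"
proof -
  have "((\<lambda>B. 3 ^ n * real B powr (\<sigma> - real n) + 3 * inverse (real B)) \<longlongrightarrow> 3 ^ n * 0 + 3 * 0) sequentially"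
    using assms by (intro tendsto_intros tendsto_neg_powr filterlim_real_sequentially
        tendsto_inverse_0_at_top) auto
  then have "\<forall>\<^sub>F B in sequentially. 3 ^ n * real B powr (\<sigma> - real n) + 3 * inverse (real B) < 1"
    by (rule order_tendstoD) simp
  then have "\<forall>\<^sub>F B in sequentially. 3 ^ n * real B powr (\<sigma> - real n) + 3 * inverse (real B) < 1 \<and> B > 1"
    using eventually_gt_at_top[of 1] by (rule eventually_conj)
  then obtain B :: nat where B: "3 ^ n * real B powr (\<sigma> - real n) + 3 * inverse (real B) < 1" "B > 1"
    using eventually_happens'[OF sequentially_bot] by blast
  have "(3 ^ n * real B powr (\<sigma> - real n) + 3 * inverse (real B)) * real B ^ n \<le> 1 * real B ^ n"
    using B by (intro mult_right_mono) auto
  moreover have "real B powr (\<sigma> - real n) * real B ^ n = real B powr \<sigma>"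
    using B by (simp add: powr_diff powr_realpow)
  moreover have "inverse (real B) * real B ^ n = real B ^ (n - 1)"
    using B assms(2) by (cases n) auto
  ultimately have "3 ^ n * real B powr \<sigma> + 3 * real B ^ (n - 1) \<le> real B ^ n"
    by (simp add: distrib_right mult.assoc)
  then show ?thesis using B by (intro exI[of _ B]) auto
qed

section \<open>Distance to the integers, and badness expressed by a uniform constant\<close>

lemma dist_nearest_int_less_iff: "dist_nearest_int x < e \<longleftrightarrow> (\<exists>p\<in>\<int>. \<bar>x - p\<bar> < e)"
proof -
  have "dist_nearest_int x = (INF p\<in>\<int>. dist x p)"
    unfolding dist_nearest_int_def by (rule infdist_notempty) (use Ints_0 in blast)
  also have "\<dots> < e \<longleftrightarrow> (\<exists>p\<in>\<int>. dist x p < e)"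
    by (rule cINF_less_iff) (use Ints_0 in \<open>auto intro!: bdd_belowI2[of _ 0]\<close>)
  finally show ?thesis by (simp add: dist_real_def)
qed

lemma dist_nearest_int_le: "p \<in> \<int> \<Longrightarrow> dist_nearest_int x \<le> \<bar>x - p\<bar>"
  unfolding dist_nearest_int_def using infdist_le[of p \<int> x] by (simp add: dist_real_def)

lemma dist_nearest_int_nonneg: "dist_nearest_int x \<ge> 0"
  unfolding dist_nearest_int_def by (rule infdist_nonneg)

lemma infnorm_int_vector_ge_1:
  fixes q :: "real ^ 'm"
  assumes "q \<in> int_vectors" "q \<noteq> 0"
  shows "infnorm q \<ge> 1"
proof -
  obtain i where i: "q $ i \<noteq> 0" using assms(2) by (auto simp: vec_eq_iff)
  have "1 \<le> \<bar>q $ i\<bar>" using assms(1) i by (auto simp: int_vectors_def intro: Ints_nonzero_abs_ge1)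
  also have "\<dots> \<le> infnorm q" by (rule component_le_infnorm_cart)
  finally show ?thesis .
qed

text \<open>Nonnegativity bounds the family below and \<open>S\<close> is nonempty, so the
  real-valued \<open>INF\<close> is a genuine infimum; itself or the given constant then serves as
  \<open>c\<close>.\<close>

lemma INF_MAX_pos_iff:
  fixes f :: "'a \<Rightarrow> 'n::finite \<Rightarrow> real"
  assumes "\<And>q j. q \<in> S \<Longrightarrow> f q j \<ge> 0" "S \<noteq> {}"
  shows "(INF q\<in>S. MAX j\<in>UNIV. f q j) > 0 \<longleftrightarrow> (\<exists>c>0. \<forall>q\<in>S. \<exists>j. c \<le> f q j)"
proof
  assume pos: "(INF q\<in>S. MAX j\<in>UNIV. f q j) > 0"
  have "\<exists>j. (INF q\<in>S. MAX j\<in>UNIV. f q j) \<le> f q j" if "q \<in> S" for q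
  proof -
    have "(INF q\<in>S. MAX j\<in>UNIV. f q j) \<le> (MAX j\<in>UNIV. f q j)"
    proof (rule cINF_lower[OF _ that])
      show "bdd_below ((\<lambda>q. MAX j\<in>UNIV. f q j) ` S)"
        using assms(1) by (intro bdd_belowI2[of _ 0]) (subst Max_ge_iff, auto)
    qed
    then show ?thesis by (subst (asm) Max_ge_iff) auto
  qed
  then show "\<exists>c>0. \<forall>q\<in>S. \<exists>j. c \<le> f q j" using pos by blast
next
  assume "\<exists>c>0. \<forall>q\<in>S. \<exists>j. c \<le> f q j"
  then obtain c where c: "c > 0" "\<And>q. q \<in> S \<Longrightarrow> \<exists>j. c \<le> f q j" by blast
  have "c \<le> (INF q\<in>S. MAX j\<in>UNIV. f q j)"
    using c(2) by (intro cINF_greatest[OF assms(2)]) (subst Max_ge_iff, auto)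
  then show "(INF q\<in>S. MAX j\<in>UNIV. f q j) > 0" using c(1) by simp
qed

lemma int_vectors_nonzero_nonempty: "int_vectors - {0 :: real ^ 'm} \<noteq> {}"
proof -
  have "1 \<in> int_vectors - {0 :: real ^ 'm}" by (auto simp: int_vectors_def vec_eq_iff)
  then show ?thesis by blast
qed

lemma Bad_iff:
  "L \<in> Bad (k :: real ^ 'n) \<longleftrightarrow> (\<exists>c>0. \<forall>q\<in>int_vectors - {0}. \<exists>j.
      c \<le> infnorm q powr (real CARD('m) * k $ j) * dist_nearest_int (((L :: real ^ 'm ^ 'n) *v q) $ j))"
  unfolding Bad_def mem_Collect_eq
  by (intro INF_MAX_pos_iff int_vectors_nonzero_nonempty mult_nonneg_nonneg dist_nearest_int_nonneg) auto

lemma Bad_affine_iff: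
  "\<alpha> \<in> Bad_affine L (k :: real ^ 'n) \<longleftrightarrow> (\<forall>j. \<alpha> $ j \<in> {0..<1}) \<and> (\<exists>c>0. \<forall>q\<in>int_vectors - {0}. \<exists>j.
      c \<le> infnorm q powr (real CARD('m) * k $ j) * dist_nearest_int (((L :: real ^ 'm ^ 'n) *v q) $ j - \<alpha> $ j))"
  unfolding Bad_affine_def mem_Collect_eq
  by (intro conj_cong refl INF_MAX_pos_iff int_vectors_nonzero_nonempty mult_nonneg_nonneg dist_nearest_int_nonneg) auto

section \<open>Obstacle sets for a single weight vector\<close>

lemma exists_power_bracket:
  assumes "(b::real) > 1" "r \<ge> 1"
  shows "\<exists>i. b ^ i \<le> r \<and> r < b ^ Suc i"
proof -
  have "\<exists>n. r < b ^ n" using assms(1) by (rule real_arch_pow)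
  then have "r < b ^ (LEAST n. r < b ^ n)" by (rule LeastI_ex)
  moreover obtain i where i: "(LEAST n. r < b ^ n) = Suc i"
    using calculation assms(2) by (cases "LEAST n. r < b ^ n") auto
  moreover have "\<not> r < b ^ i" by (rule not_less_Least) (simp add: i)
  ultimately show ?thesis by (metis not_less)
qed

text \<open>
  With \<open>b\<close> chosen such that \<open>b powr K = B ^ D\<close>, where \<open>K\<close> is the largest exponent \<open>a j\<close>, the shell
  \<open>b ^ i \<le> infnorm q < b ^ Suc i\<close> is treated at level \<open>s0 + D * i\<close>. The offset \<open>s0\<close> is what makes
  the cubes of that level small compared with the separation of the boxes; it leaves no shell
  untreated because \<open>infnorm q \<ge> 1 = b ^ 0\<close>.
\<close>

lemma exists_obstacle_sets:
  fixes L :: "real ^ 'm ^ 'n" and k :: "real ^ 'n" and B D e :: nat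
  assumes L: "L \<in> Bad k" and k: "\<And>j. k $ j > 0" and B: "B > 1" and D: "D > 0" and e: "e < D"
  shows "\<exists>E :: nat \<Rightarrow> (real ^ 'n) set.
     (\<forall>s. s mod D \<noteq> e \<longrightarrow> E s = {}) \<and>
     (\<forall>s. \<exists>j. \<forall>x\<in>E s. \<forall>y\<in>E s. (\<forall>i. \<bar>x $ i - y $ i\<bar> \<le> (1 / real B) ^ s)
        \<longrightarrow> \<bar>x $ j - y $ j\<bar> \<le> (1 / real B) ^ Suc s) \<and>
     (\<forall>x. (\<forall>i. x $ i \<in> {0..<1}) \<and> (\<forall>s\<ge>1. x \<notin> E s) \<longrightarrow> x \<in> Bad_affine L k)"
proof -
  define a where "a j = real CARD('m) * k $ j" for j
  have a0: "a j > 0" for j using k by (simp add: a_def)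
  obtain J where J: "\<And>j. a j \<le> a J"
  proof -
    have "Max (range a) \<in> range a" by (intro Max_in) auto
    then obtain J where "Max (range a) = a J" by (rule rangeE)
    then have "a j \<le> a J" for j by (metis Max_ge finite finite_imageI rangeI)
    then show ?thesis using that by blast
  qed
  define K where "K = a J"
  have K0: "K > 0" and aK: "\<And>j. a j \<le> K" using a0 J by (auto simp: K_def)
  obtain c0 where c0: "c0 > 0" "\<And>q. q \<in> int_vectors - {0} \<Longrightarrow>
      \<exists>j. c0 \<le> infnorm q powr a j * dist_nearest_int ((L *v q) $ j)"
    using L unfolding Bad_iff a_def by blast
  define b where "b = real B powr (real D / K)"
  have b1: "b > 1" using B D K0 by (simp add: b_def)
  have bK: "(b ^ i) powr K = real B ^ (D * i)" for i
    using B K0 by (simp add: b_def powr_powr powr_realpow[symmetric] mult.commute)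
  define \<beta> where "\<beta> = 1 / real B"
  have \<beta>: "0 < \<beta>" "\<beta> < 1" "\<beta> \<le> 1 / 2" using B by (auto simp: \<beta>_def field_simps)
  \<comment> \<open>Vectors of one shell differ by less than \<open>2 * b\<close> times its lower
    radius. This \<open>N\<close> makes the two error terms of the separation argument, each at most
    \<open>\<beta> ^ s0\<close> after scaling, too small for the constant \<open>c0\<close>.\<close>
  obtain N where N: "\<beta> ^ N < c0 * (2 * b) powr (- K) / 2"
    using real_arch_pow_inv[of "c0 * (2 * b) powr (- K) / 2" \<beta>] c0(1) b1 \<beta> by auto
  \<comment> \<open>The offset is congruent to \<open>e\<close> modulo \<open>D\<close>, at least
    \<open>N\<close>, and at least 1, since level 0 may not carry an obstacle.\<close>
  define s0 where "s0 = e + D * Suc N"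
  have s0: "s0 \<ge> 1" "s0 \<ge> N"
    using D by (auto simp: s0_def Suc_le_eq intro: le_trans[of N "D * N"] trans_le_add2)
  have "\<beta> ^ s0 \<le> \<beta> ^ N" using s0 \<beta> by (intro power_decreasing) auto
  then have "2 * \<beta> ^ s0 < c0 * (2 * b) powr (- K)" using N by linarith
  then have "(2 * b) powr K * (2 * \<beta> ^ s0) < (2 * b) powr K * (c0 * (2 * b) powr (- K))"
    using b1 by (intro mult_strict_left_mono) auto
  also have "\<dots> = c0" using b1 by (simp add: powr_minus field_simps)
  finally have small: "(2 * b) powr K * (2 * \<beta> ^ s0) < c0" .
  \<comment> \<open>With \<open>X = b ^ i\<close> and \<open>s = s0 + D * i\<close> one has
    \<open>X powr K * \<beta> ^ s = \<beta> ^ s0\<close>. Hence the slab thickness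
    \<open>2 * c * X powr (- K)\<close> is exactly \<open>\<beta> ^ Suc s\<close>, the side of the
    next subcubes.\<close>
  define c where "c = \<beta> ^ Suc s0 / 2"
  have c: "c > 0" using \<beta> by (simp add: c_def)
  define E where "E s = {x. \<exists>i q. s = s0 + D * i \<and> q \<in> int_vectors - {0} \<and> b ^ i \<le> infnorm q \<and> infnorm q < b ^ Suc i
      \<and> (\<forall>j. dist_nearest_int ((L *v q) $ j - x $ j) < c * infnorm q powr (- a j))}" for s
  have E1: "E s = {}" if "s mod D \<noteq> e" for s
  proof -
    have "(s0 + D * i) mod D = e" for i
    proof -
      have "s0 + D * i = e + D * (Suc N + i)" by (simp add: s0_def algebra_simps)
      then show ?thesis using e by (simp only: mod_mult_self2 mod_less)
    qed
    then show ?thesis using that by (auto simp: E_def)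
  qed
  have E2: "\<bar>x $ J - y $ J\<bar> \<le> \<beta> ^ Suc s"
    if xs: "x \<in> E s" and ys: "y \<in> E s" and near: "\<And>i. \<bar>x $ i - y $ i\<bar> \<le> \<beta> ^ s" for s x y
  proof -
    obtain i q where q: "s = s0 + D * i" "q \<in> int_vectors - {0}" "b ^ i \<le> infnorm q" "infnorm q < b ^ Suc i"
      "\<And>j. dist_nearest_int ((L *v q) $ j - x $ j) < c * infnorm q powr (- a j)"
      using xs by (auto simp: E_def)
    obtain i' q' where q': "s = s0 + D * i'" "q' \<in> int_vectors - {0}" "b ^ i' \<le> infnorm q'" "infnorm q' < b ^ Suc i'"
      "\<And>j. dist_nearest_int ((L *v q') $ j - y $ j) < c * infnorm q' powr (- a j)"
      using ys by (auto simp: E_def)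
    have "i' = i" using q(1) q'(1) D by simp
    define X where "X = b ^ i"
    have X: "X \<ge> 1" using b1 by (simp add: X_def)
    have XK: "X powr K * \<beta> ^ s = \<beta> ^ s0"
      using B by (simp add: X_def bK q(1) \<beta>_def power_add field_simps)
    have "c * infnorm r powr (- a j) \<le> c * X powr (- a j)" if "b ^ i \<le> infnorm r" for r :: "real ^ 'm" and j
      using that X c a0[of j] by (intro mult_left_mono powr_mono2') (auto simp: X_def)
    then have "dist_nearest_int ((L *v q) $ j - x $ j) < c * X powr (- a j)"
      "dist_nearest_int ((L *v q') $ j - y $ j) < c * X powr (- a j)" for j
      using q(3,5) q'(3,5) unfolding \<open>i' = i\<close> by (meson less_le_trans)+
    then obtain p p' where p: "\<And>j. p j \<in> \<int>" "\<And>j. \<bar>(L *v q) $ j - x $ j - p j\<bar> < c * X powr (- a j)"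
      and p': "\<And>j. p' j \<in> \<int>" "\<And>j. \<bar>(L *v q') $ j - y $ j - p' j\<bar> < c * X powr (- a j)"
      unfolding dist_nearest_int_less_iff by metis
    \<comment> \<open>Otherwise \<open>q - q'\<close> is a nonzero integer vector. By nearness of
      \<open>x\<close> and \<open>y\<close>, every coordinate of its image under \<open>L\<close> is
      close to an integer, which contradicts the lower bound \<open>c0\<close>.\<close>
    have "q = q'"
    proof (rule ccontr)
      assume "q \<noteq> q'"
      then have "q - q' \<in> int_vectors - {0}" using q(2) q'(2) by (auto simp: int_vectors_def)
      then obtain j where j: "c0 \<le> infnorm (q - q') powr a j * dist_nearest_int ((L *v (q - q')) $ j)"
        using c0(2) by blast
      have "infnorm (q - q') \<le> infnorm q + infnorm q'"
        using infnorm_triangle[of q "- q'"] by (simp add: infnorm_neg)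
      also have "\<dots> \<le> 2 * b * X" using q(4) q'(4) by (simp add: X_def \<open>i' = i\<close>)
      finally have le1: "infnorm (q - q') powr a j \<le> (2 * b * X) powr a j"
        using a0[of j] by (intro powr_mono2) (auto simp: infnorm_pos_le)
      have "dist_nearest_int ((L *v (q - q')) $ j) \<le> \<bar>(L *v (q - q')) $ j - (p j - p' j)\<bar>"
        using p(1) p'(1) by (intro dist_nearest_int_le) auto
      also have "\<dots> = \<bar>(L *v q) $ j - (L *v q') $ j - (p j - p' j)\<bar>"
        by (simp add: matrix_vector_mult_diff_distrib)
      also have "\<dots> \<le> 2 * (c * X powr (- a j)) + \<beta> ^ s"
        using p(2)[of j] p'(2)[of j] near[of j] by linarith
      finally have le2: "dist_nearest_int ((L *v (q - q')) $ j) \<le> 2 * (c * X powr (- a j)) + \<beta> ^ s" .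
      have "c0 \<le> (2 * b * X) powr a j * (2 * (c * X powr (- a j)) + \<beta> ^ s)"
        by (rule order_trans[OF j mult_mono[OF le1 le2]]) (auto simp: dist_nearest_int_nonneg)
      also have "\<dots> = (2 * b) powr a j * (2 * c + X powr a j * \<beta> ^ s)"
        using b1 X by (simp add: powr_mult powr_minus field_simps)
      \<comment> \<open>All exponents may be raised to \<open>K\<close> because \<open>2 * b\<close>
        and \<open>X\<close> are at least 1. Then both summands in the bracket are at most
        \<open>\<beta> ^ s0\<close>.\<close>
      also have "\<dots> \<le> (2 * b) powr K * (2 * c + X powr K * \<beta> ^ s)"
        using b1 X aK[of j] c \<beta> by (intro mult_mono add_mono mult_right_mono powr_mono) auto
      also have "\<dots> \<le> (2 * b) powr K * (2 * \<beta> ^ s0)"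
        using \<beta> XK by (intro mult_left_mono) (auto simp: c_def mult_le_cancel_right1)
      finally show False using small by simp
    qed
    \<comment> \<open>Both points now belong to boxes of the same \<open>q\<close>, possibly about
      different integer translates. As \<open>s\<close> is at least 1 and \<open>\<beta>\<close> at
      most 1/2, the two integers differ by less than 1, so they agree.\<close>
    have lt: "\<bar>x $ J - y $ J - (p' J - p J)\<bar> < 2 * c * X powr (- K)"
      using p(2)[of J] p'(2)[of J] unfolding \<open>q = q'\<close> K_def by linarith
    have "X powr (- K) \<le> X powr 0" using X K0 by (intro powr_mono) auto
    then have "2 * c * X powr (- K) \<le> 2 * c * 1"
      using c X by (intro mult_left_mono) auto
    moreover have "2 * c \<le> \<beta> ^ 1" unfolding c_def using \<beta> by (simp add: mult_le_cancel_left1 power_le_one)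
    moreover have "\<beta> ^ s \<le> \<beta> ^ 1" using \<beta> s0 q(1) by (intro power_decreasing) auto
    ultimately have "\<bar>p' J - p J\<bar> < 1" using lt near[of J] \<beta>(3) by simp
    moreover have "p' J - p J \<in> \<int>" using p(1) p'(1) by simp
    ultimately have "p' J - p J = 0" using Ints_nonzero_abs_less1 by blast
    then have "\<bar>x $ J - y $ J\<bar> \<le> 2 * c * X powr (- K)" using lt by simp
    also have "\<dots> = \<beta> * (\<beta> ^ s0 * X powr (- K))" by (simp add: c_def)
    also have "\<beta> ^ s0 * X powr (- K) = \<beta> ^ s" unfolding XK[symmetric] using X by (simp add: powr_minus)
    finally show ?thesis by simp
  qed
  have E3: "x \<in> Bad_affine L k" if x: "\<And>i. x $ i \<in> {0..<1}" and notin: "\<And>s. s \<ge> 1 \<Longrightarrow> x \<notin> E s" for x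
    unfolding Bad_affine_iff a_def[symmetric]
  proof (intro conjI allI x exI[of _ c] c ballI)
    fix q :: "real ^ 'm" assume q: "q \<in> int_vectors - {0}"
    then have q1: "infnorm q \<ge> 1" by (intro infnorm_int_vector_ge_1) auto
    obtain i where "b ^ i \<le> infnorm q" "infnorm q < b ^ Suc i"
      using exists_power_bracket[OF b1 q1] by blast
    moreover have "x \<notin> E (s0 + D * i)" using s0 by (intro notin) auto
    ultimately have "\<not> (\<forall>j. dist_nearest_int ((L *v q) $ j - x $ j) < c * infnorm q powr (- a j))"
      using q unfolding E_def by blast
    then obtain j where "c * infnorm q powr (- a j) \<le> dist_nearest_int ((L *v q) $ j - x $ j)"
      by (auto simp: not_less)
    then have "infnorm q powr a j * (c * infnorm q powr (- a j)) \<le> infnorm q powr a j * dist_nearest_int ((L *v q) $ j - x $ j)"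
      by (intro mult_left_mono) auto
    also have "infnorm q powr a j * (c * infnorm q powr (- a j)) = c"
      using q1 by (simp add: powr_minus)
    finally show "\<exists>j. c \<le> infnorm q powr a j * dist_nearest_int ((L *v q) $ j - x $ j)" by blast
  qed
  show ?thesis
    using E1 E2 E3 unfolding \<beta>_def[symmetric] by (intro exI[of _ E]) blast
qed

section \<open>Interleaving the levels of all weight vectors\<close>

text \<open>The residue condition says that \<open>t\<close> is the exact exponent of 2 in
  \<open>s\<close>.\<close>

lemma power_2_residue_unique:
  assumes "s mod 2 ^ Suc t = (2::nat) ^ t" "s mod 2 ^ Suc t' = 2 ^ t'"
  shows "t = t'"
proof (rule ccontr)
  have *: False if "s mod 2 ^ Suc t = (2::nat) ^ t" "s mod 2 ^ Suc t' = 2 ^ t'" "t < t'" for t t'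
  proof -
    have dvd: "(2::nat) ^ Suc t dvd 2 ^ t'" "(2::nat) ^ Suc t dvd 2 ^ Suc t'"
      using that(3) by (auto simp del: power_Suc intro!: le_imp_power_dvd)
    then have "2 ^ Suc t dvd s" using that(2) by (metis dvd_mod_iff)
    then show False using that(1) by simp
  qed
  assume "t \<noteq> t'"
  then show False using *[of t t'] *[of t' t] assms by (cases t t' rule: linorder_cases) auto
qed

theorem corollary1p2:
  fixes k :: "nat \<Rightarrow> real ^ 'n" and L :: "real ^ 'm ^ 'n"
  assumes "\<And>t j. t \<ge> 1 \<Longrightarrow> k t $ j > 0"
    and "\<And>t. t \<ge> 1 \<Longrightarrow> (\<Sum>j\<in>UNIV. k t $ j) = 1"
    and "L \<in> (\<Inter>t\<in>{1..}. Bad (k t))"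
  shows "hausdorff_dim (\<Inter>t\<in>{1..}. Bad_affine L (k t)) = of_nat CARD('n)"
proof (rule hausdorff_dim_eqI)
  let ?A = "\<Inter>t\<in>{1..}. Bad_affine L (k t)"
  have "?A \<subseteq> Bad_affine L (k 1)" by (rule INF_lower) simp
  also have "\<dots> \<subseteq> cube 0 1" by (simp add: Bad_affine_def mem_cube subset_iff order_less_imp_le)
  finally show "?A \<subseteq> cube 0 1" .
  fix s :: real assume s: "0 \<le> s" "s < real CARD('n)"
  \<comment> \<open>The midpoint is positive even for \<open>s = 0\<close> and still below the
    dimension, as the choice of the base \<open>B\<close> requires.\<close>
  define \<sigma> where "\<sigma> = (s + real CARD('n)) / 2"
  have \<sigma>: "s \<le> \<sigma>" "0 < \<sigma>" "\<sigma> < real CARD('n)" using s by (auto simp: \<sigma>_def)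
  obtain B where B: "B > 1" "3 ^ CARD('n) * real B powr \<sigma> \<le> real B ^ CARD('n) - 3 * real B ^ (CARD('n) - 1)"
    using exists_base[OF \<sigma>(3)] by auto
  \<comment> \<open>Here the modulus is \<open>2 ^ Suc t\<close> and the residue
    \<open>2 ^ t\<close>. The weight vector is \<open>k (Suc t)\<close> because \<open>t\<close>
    starts at 0 while the sequence starts at 1.\<close>
  have "\<exists>E :: nat \<Rightarrow> (real ^ 'n) set.
     (\<forall>s. s mod 2 ^ Suc t \<noteq> 2 ^ t \<longrightarrow> E s = {}) \<and>
     (\<forall>s. \<exists>j. \<forall>x\<in>E s. \<forall>y\<in>E s. (\<forall>i. \<bar>x $ i - y $ i\<bar> \<le> (1 / real B) ^ s)
        \<longrightarrow> \<bar>x $ j - y $ j\<bar> \<le> (1 / real B) ^ Suc s) \<and>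
     (\<forall>x. (\<forall>i. x $ i \<in> {0..<1}) \<and> (\<forall>s\<ge>1. x \<notin> E s) \<longrightarrow> x \<in> Bad_affine L (k (Suc t)))" for t :: nat
    using assms(1,3) B(1) by (intro exists_obstacle_sets) auto
  then obtain E :: "nat \<Rightarrow> nat \<Rightarrow> (real ^ 'n) set" where
    E1: "\<And>t s. s mod 2 ^ Suc t \<noteq> 2 ^ t \<Longrightarrow> E t s = {}" and
    E2: "\<And>t s. \<exists>j. \<forall>x\<in>E t s. \<forall>y\<in>E t s. (\<forall>i. \<bar>x $ i - y $ i\<bar> \<le> (1 / real B) ^ s)
        \<longrightarrow> \<bar>x $ j - y $ j\<bar> \<le> (1 / real B) ^ Suc s" and
    E3: "\<And>t x. (\<forall>i. x $ i \<in> {0..<1}) \<Longrightarrow> (\<forall>s\<ge>1. x \<notin> E t s) \<Longrightarrow> x \<in> Bad_affine L (k (Suc t))"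
    by metis
  \<comment> \<open>At most one \<open>t\<close> has a nonempty obstacle at level \<open>s\<close>,
    so the union inherits the slab property, with a direction \<open>j\<close> that may change from
    level to level.\<close>
  have E: "\<exists>j. \<forall>x\<in>(\<Union>t. E t s). \<forall>y\<in>(\<Union>t. E t s). (\<forall>i. \<bar>x $ i - y $ i\<bar> \<le> (1 / real B) ^ s)
        \<longrightarrow> \<bar>x $ j - y $ j\<bar> \<le> (1 / real B) ^ Suc s" for s
  proof (cases "\<exists>t. s mod 2 ^ Suc t = 2 ^ t")
    case True
    then obtain t where "s mod 2 ^ Suc t = 2 ^ t" by blast
    then have "(\<Union>t. E t s) = E t s"
      using E1[of s] power_2_residue_unique[of s t] by blast
    then show ?thesis using E2 by simp
  next
    case False
    then have "(\<Union>t. E t s) = {}" using E1[of s] by blast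
    then show ?thesis by simp
  qed
  show "hausdorff_measure s ?A \<noteq> 0"
  proof (rule hausdorff_measure_pos_if_not_covered[OF s(1) \<sigma>(1,2)])
    show "((1 / real B) ^ 2) powr \<sigma> > 0" using B(1) by simp
    fix U :: "nat \<Rightarrow> (real ^ 'n) set" and d
    assume U: "\<And>i x y. x \<in> U i \<Longrightarrow> y \<in> U i \<Longrightarrow> dist x y \<le> d i" "\<And>i. d i > 0"
      "summable (\<lambda>i. d i powr \<sigma>)" "(\<Sum>i. d i powr \<sigma>) < ((1 / real B) ^ 2) powr \<sigma>"
    obtain x where x: "\<forall>i. x $ i \<in> {0..<1}" "\<forall>i. x \<notin> U i" "\<forall>s\<ge>1. x \<notin> (\<Union>t. E t s)"
      using exists_point_avoiding[OF B(2,1) \<sigma>(2) E U] by blast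
    have "x \<in> Bad_affine L (k t)" if "t \<ge> 1" for t
      using E3[of x "t - 1"] x that by simp
    then show "\<not> ?A \<subseteq> (\<Union>i. U i)" using x(2) by blast
  qed
qed

end
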